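(* Let $G$ and $H$ be two nontrivial connected graphs such that the strong product $G\boxtimes H$ is not complete. Then $tpc(G\boxtimes H)=3$.
   Context: All graphs are simple, finite and undirected; nontrivial means having at least two vertices. The strong product $G\boxtimes H$ has vertex set $V(G)\times V(H)$, with $(g,h)$ adjacent to $(g',h')$ iff either ($gg'\in E(G)$ and $h=h'$), or ($g=g'$ and $hh'\in E(H)$), or ($gg'\in E(G)$ and $hh'\in E(H)$). A graph is total-colored if all its vertices and edges are assigned colors. A path in a total-colored graph is a total proper path if (i) any two adjacent edges on the path differ in color, (ii) any two adjacent internal vertices of the path differ in color, and (iii) every internal vertex of the path differs in color from the edges of the path incident with it. A total-colored graph is total-proper connected if any two vertices are joined by a total proper path. For a connected graph $G$, $tpc(G)$ is the smallest number of colors in a total-coloring making $G$ total-proper connected. *)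

theory Defs
  imports "Graph_Theory.Graph_Theory"
begin

text \<open>
  A finite simple undirected graph is a \<^locale>\<open>pair_graph\<close>: finite, loop-free, with a symmetric
  arc relation. The two arcs \<open>(u, v)\<close> and \<open>(v, u)\<close> together represent the one undirected edge
  \<open>{u, v}\<close>, and it is these two-element sets that receive colors.
\<close>

definition edges :: "'a pair_pre_digraph \<Rightarrow> 'a set set" where
  "edges G = {{u, v} | u v. (u, v) \<in> parcs G}"

definition nontrivial :: "'a pair_pre_digraph \<Rightarrow> bool" where
  "nontrivial G \<longleftrightarrow> 2 \<le> card (pverts G)"

definition complete_graph :: "'a pair_pre_digraph \<Rightarrow> bool" where
  "complete_graph G \<longleftrightarrow> (\<exists>n. complete_digraph n (with_proj G))"

definition strong_product ::
    "'a pair_pre_digraph \<Rightarrow> 'b pair_pre_digraph \<Rightarrow> ('a \<times> 'b) pair_pre_digraph"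
    (infixl \<open>\<boxtimes>\<close> 70) where
  "G \<boxtimes> H =
    \<lparr> pverts = pverts G \<times> pverts H,
      parcs = {((g, h), (g', h')) | g h g' h'.
        g \<in> pverts G \<and> h \<in> pverts H \<and> g' \<in> pverts G \<and> h' \<in> pverts H \<and>
        ((g, g') \<in> parcs G \<and> h = h' \<or>
         g = g' \<and> (h, h') \<in> parcs H \<or>
         (g, g') \<in> parcs G \<and> (h, h') \<in> parcs H)} \<rparr>"

lemma pair_graph_strong_product:
  assumes "pair_graph G" "pair_graph H"
  shows "pair_graph (G \<boxtimes> H)"
proof -
  interpret G: pair_graph G by fact
  interpret H: pair_graph H by fact
  have fin: "finite (pverts (G \<boxtimes> H))"
    by (simp add: strong_product_def G.pair_finite_verts H.pair_finite_verts)
  have sub: "parcs (G \<boxtimes> H) \<subseteq> pverts (G \<boxtimes> H) \<times> pverts (G \<boxtimes> H)"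
    by (auto simp: strong_product_def)
  have sG: "(v, u) \<in> parcs G" if "(u, v) \<in> parcs G" for u v
    using G.pair_sym_arcs that by (auto simp: symmetric_def sym_def)
  have sH: "(v, u) \<in> parcs H" if "(u, v) \<in> parcs H" for u v
    using H.pair_sym_arcs that by (auto simp: symmetric_def sym_def)
  show ?thesis
  proof unfold_locales
    show "finite (parcs (G \<boxtimes> H))"
      using sub fin by (meson finite_SigmaI finite_subset)
    show "symmetric (with_proj (G \<boxtimes> H))"
      by (auto simp: symmetric_def sym_def strong_product_def intro: sG sH)
    show "fst e \<noteq> snd e" if "e \<in> parcs (G \<boxtimes> H)" for e
      using that by (auto simp: strong_product_def dest: G.pair_no_loops H.pair_no_loops)
  qed (use fin sub in auto)
qed

text \<open>
  A path is a list \<open>p\<close> of distinct, consecutively adjacent vertices (\<^const>\<open>vpath\<close>); its internal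
  vertices are \<open>p ! i\<close> with \<open>0 < i\<close> and \<open>i + 1 < length p\<close>. In the second condition both \<open>p ! i\<close>
  and \<open>p ! (i + 1)\<close> are internal. Vertices are colored by \<open>vc\<close>, edges by \<open>ec\<close>; only
  the values on the vertices and edges of the graph matter.
\<close>

definition total_proper_path ::
    "'a pair_pre_digraph \<Rightarrow> ('a \<Rightarrow> nat) \<Rightarrow> ('a set \<Rightarrow> nat) \<Rightarrow> 'a list \<Rightarrow> bool" where
  "total_proper_path G vc ec p \<longleftrightarrow>
    vpath p (with_proj G) \<and>
    (\<forall>i. i + 2 < length p \<longrightarrow>
       ec {p ! i, p ! (i + 1)} \<noteq> ec {p ! (i + 1), p ! (i + 2)}) \<and>
    (\<forall>i. 0 < i \<and> i + 2 < length p \<longrightarrow> vc (p ! i) \<noteq> vc (p ! (i + 1))) \<and>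
    (\<forall>i. 0 < i \<and> i + 1 < length p \<longrightarrow>
       vc (p ! i) \<noteq> ec {p ! (i - 1), p ! i} \<and> vc (p ! i) \<noteq> ec {p ! i, p ! (i + 1)})"

definition total_proper_connected ::
    "'a pair_pre_digraph \<Rightarrow> ('a \<Rightarrow> nat) \<Rightarrow> ('a set \<Rightarrow> nat) \<Rightarrow> bool" where
  "total_proper_connected G vc ec \<longleftrightarrow>
    (\<forall>u \<in> pverts G. \<forall>v \<in> pverts G. u \<noteq> v \<longrightarrow>
       (\<exists>p. total_proper_path G vc ec p \<and> hd p = u \<and> last p = v))"

text \<open>
  The least number of colors occurring in a total-coloring that makes \<open>G\<close> total-proper connected.
  Meaningful for finite connected \<open>G\<close>, where giving all vertices and edges pairwise different
  colors shows that such a coloring exists.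
\<close>

definition tpc :: "'a pair_pre_digraph \<Rightarrow> nat" where
  "tpc G = (LEAST k. \<exists>vc ec. total_proper_connected G vc ec \<and>
                             card (vc ` pverts G \<union> ec ` edges G) = k)"

end

theory Submission
  imports Defs
begin

text \<open>
  Along a total proper path that uses only three colors, the colors of vertices and edges are
  forced to run cyclically, so orient every edge whose end colors differ by one modulo 3 and give
  it the third color: directed paths are then total proper, and it suffices that the orientation
  is strongly connected. Coloring \<open>(g, h)\<close> by the sum of the parities of the distances of \<open>g\<close> and
  \<open>h\<close> from fixed roots achieves this: two parity-changing edges, one of \<open>G\<close> and one of \<open>H\<close>, span a
  complete graph on four vertices with colors 0, 1, 1, 2, which is covered by two directed
  triangles, and these complete graphs link up to the whole product.
\<close>

section \<open>From reachability to directed paths\<close>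

lemma nth_in_vwalk_arcs:
  "i + 1 < length p \<Longrightarrow> (p ! i, p ! (i + 1)) \<in> set (vwalk_arcs p)"
proof (induction p arbitrary: i rule: vwalk_arcs.induct)
  case (3 x y xs)
  then show ?case by (cases i) auto
qed auto

text \<open>A chain of arcs gives a walk, and cutting out its cycles gives a path. Making
  \<open>D\<close> the whole arc set of a digraph keeps the shortened path inside
  \<open>D\<close>.\<close>

lemma rtrancl_vpath:
  assumes "(u, v) \<in> D\<^sup>*" "u \<in> V" "D \<subseteq> V \<times> V"
  obtains p where "vpath p (with_proj \<lparr>pverts = V, parcs = D\<rparr>)" "hd p = u" "last p = v"
proof -
  let ?G = "with_proj \<lparr>pverts = V, parcs = D\<rparr>"
  have "\<exists>p. vwalk p ?G \<and> hd p = u \<and> last p = v"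
    using assms(1,2)
  proof (induction rule: converse_rtrancl_induct)
    case base
    then show ?case by (intro exI[of _ "[v]"]) (auto simp: vwalk_def)
  next
    case (step y z)
    then obtain p where "vwalk p ?G" "hd p = z" "last p = v"
      using assms(3) by auto
    with step show ?case
      by (intro exI[of _ "y # p"]) (auto intro!: vwalk_consI)
  qed
  then obtain p where "vwalk p ?G" "hd p = u" "last p = v"
    by blast
  from vwalk_imp_ex_vpath[OF this] show ?thesis
    using that by blast
qed

section \<open>Connectedness by parity-changing edges\<close>

text \<open>Along a shortest path from \<open>r\<close> the distance grows by exactly one at each
  arc, so its parity flips at each arc.\<close>

lemma parity_bipartition:
  obtains f :: "'a \<Rightarrow> bool"
  where "\<And>v. (r, v) \<in> R\<^sup>* \<Longrightarrow> (r, v) \<in> {(x, y) \<in> R. f x \<noteq> f y}\<^sup>*"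
proof -
  define d where "d v = (LEAST n. (r, v) \<in> R ^^ n)" for v
  define f where "f v \<longleftrightarrow> even (d v)" for v
  have path: "(r, v) \<in> R ^^ d v" if "(r, v) \<in> R\<^sup>*" for v
    using that unfolding d_def rtrancl_power by (rule LeastI_ex)
  have least: "d v \<le> n" if "(r, v) \<in> R ^^ n" for v n
    using that unfolding d_def by (rule Least_le)
  have "(r, v) \<in> {(x, y) \<in> R. f x \<noteq> f y}\<^sup>*" if "(r, v) \<in> R\<^sup>*" "d v = n" for v n
    using that
  proof (induction n arbitrary: v)
    case 0
    with path[of v] show ?case by simp
  next
    case (Suc n)
    with path[of v] obtain y where y: "(r, y) \<in> R ^^ n" "(y, v) \<in> R"
      by (auto elim: relpow_Suc_E)
    have reach: "(r, y) \<in> R\<^sup>*"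
      using y(1) by (rule relpow_imp_rtrancl)
    \<comment> \<open>This gives \<open>Suc n \<le> Suc (d y)\<close>, which together with
      \<open>d y \<le> n\<close> pins the distance of the predecessor.\<close>
    have "(r, v) \<in> R ^^ Suc (d y)"
      using path[OF reach] y(2) by auto
    from least[OF this] least[OF y(1)] Suc.prems(2) have "d y = n"
      by simp
    moreover have "f y \<noteq> f v"
      using calculation Suc.prems(2) by (simp add: f_def)
    ultimately show ?case
      using Suc.IH[OF reach] y(2) by (auto intro: rtrancl_into_rtrancl)
  qed
  then show ?thesis
    using that by blast
qed

text \<open>Both adjacency and the change of parity are symmetric, so any two vertices are joined by
  going back to the root \<open>r\<close> and out again.\<close>

lemma (in pair_graph) connected_parity_bipartition:
  assumes "Digraph_Component.connected (with_proj G)"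
  obtains f :: "'a \<Rightarrow> bool"
  where "\<And>u v. u \<in> pverts G \<Longrightarrow> v \<in> pverts G \<Longrightarrow> (u, v) \<in> {(x, y) \<in> parcs G. f x \<noteq> f y}\<^sup>*"
proof -
  obtain r where r: "r \<in> pverts G"
    using assms by (auto simp: connected_def strongly_connected_def)
  have reach: "(r, v) \<in> (parcs G)\<^sup>*" if "v \<in> pverts G" for v
  proof -
    have "r \<rightarrow>\<^sup>*\<^bsub>with_proj (mk_symmetric (with_proj G))\<^esub> v"
      using assms r that by (auto simp: connected_def strongly_connected_def)
    then have "r \<rightarrow>\<^sup>*\<^bsub>with_proj G\<^esub> v"
      using reachable_mk_symmetric_eq[OF pair_sym_arcs] by simp
    then show ?thesis
      using reachable_rtranclI by fastforce
  qed
  obtain f :: "'a \<Rightarrow> bool" where f: "\<And>v. (r, v) \<in> (parcs G)\<^sup>* \<Longrightarrow> (r, v) \<in> {(x, y) \<in> parcs G. f x \<noteq> f y}\<^sup>*"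
    using parity_bipartition[of r "parcs G"] by blast
  let ?S = "{(x, y) \<in> parcs G. f x \<noteq> f y}"
  have "sym ?S"
    using pair_sym_arcs by (auto simp: symmetric_def sym_def)
  then have "sym (?S\<^sup>*)"
    by (rule sym_rtrancl)
  then have "(u, v) \<in> ?S\<^sup>*" if "u \<in> pverts G" "v \<in> pverts G" for u v
    using f[OF reach[OF that(1)]] f[OF reach[OF that(2)]] by (meson rtrancl_trans symD)
  then show ?thesis
    using that by blast
qed

text \<open>This is where nontriviality enters: every vertex of a factor has a parity-changing edge
  from which a four-vertex block can be built.\<close>

lemma rtrancl_out_arc:
  assumes "\<And>u v. u \<in> V \<Longrightarrow> v \<in> V \<Longrightarrow> (u, v) \<in> S\<^sup>*" "2 \<le> card V" "u \<in> V"
  obtains v where "(u, v) \<in> S"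
proof -
  have "\<not> V \<subseteq> {u}"
    using assms(2) card_mono[of "{u}" V] by auto
  then obtain w where "w \<in> V" "w \<noteq> u"
    by blast
  with assms(1)[OF assms(3)] show ?thesis
    using that by (metis converse_rtranclE)
qed

section \<open>Orientation and coloring from vertex colors modulo 3\<close>

text \<open>
  Three distinct colors sum to \<open>0\<close> modulo 3, so the third one is minus the sum of the other two;
  the factor \<open>2\<close> plays the role of \<open>-1\<close>.
\<close>

definition third_color :: "('a \<Rightarrow> nat) \<Rightarrow> 'a set \<Rightarrow> nat" where
  "third_color c e = 2 * sum c e mod 3"

definition ascending_arcs :: "'a pair_pre_digraph \<Rightarrow> ('a \<Rightarrow> nat) \<Rightarrow> 'a rel" where
  "ascending_arcs G c = {(x, y) \<in> parcs G. c y = (c x + 1) mod 3}"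

text \<open>Read alternately, the colors of vertices and edges along \<open>p\<close> are
  \<open>a\<close>, \<open>a + 2\<close>, \<open>a + 1\<close>, \<open>a\<close>, ... modulo 3.
  Every comparison in a total proper path is between entries one or two places apart, and these
  always differ.\<close>

lemma (in pair_graph) total_proper_path_ascending:
  assumes c: "\<And>x. c x < 3"
    and p: "vpath p (with_proj \<lparr>pverts = pverts G, parcs = ascending_arcs G c\<rparr>)"
  shows "total_proper_path G c (third_color c) p"
proof -
  have step: "c (p ! Suc i) = (c (p ! i) + 1) mod 3" if "Suc i < length p" for i
    using p nth_in_vwalk_arcs[of i p] that
    by (auto simp: vpath_def vwalk_def ascending_arcs_def)
  have edge: "third_color c {p ! i, p ! Suc i} = (c (p ! i) + 2) mod 3" if "Suc i < length p" for i
  proof -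
    \<comment> \<open>Distinct ends make the sum over the edge have two terms, \<open>a\<close> and
      \<open>a + 1\<close> modulo 3; doubled, they give \<open>4 * a + 2\<close>, that is
      \<open>a + 2\<close>.\<close>
    have "p ! i \<noteq> p ! Suc i"
      using p that by (auto simp: vpath_def nth_eq_iff_index_eq)
    moreover have "c (p ! i) \<in> {0, 1, 2}"
      using c[of "p ! i"] by auto
    ultimately show ?thesis
      using step[OF that] by (auto simp: third_color_def)
  qed
  \<comment> \<open>In order: a vertex and its next edge, consecutive vertices, consecutive edges, a
    vertex and its previous edge.\<close>
  have mod3: "(a + 2) mod 3 \<noteq> a" "(a + 1) mod 3 \<noteq> a" "((a + 1) mod 3 + 2) mod 3 \<noteq> (a + 2) mod 3"
    "(a + 1) mod 3 \<noteq> (a + 2) mod 3" if "a < 3" for a :: nat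
    using that by presburger+
  have "vpath p (with_proj G)"
    using p by (auto simp: vpath_def vwalk_def ascending_arcs_def)
  moreover have "third_color c {p ! i, p ! (i + 1)} \<noteq> third_color c {p ! (i + 1), p ! (i + 2)}"
    if "i + 2 < length p" for i
    using that edge[of i] edge[of "Suc i"] step[of i] mod3(3)[OF c, of "p ! i"] by simp
  moreover have "c (p ! i) \<noteq> c (p ! (i + 1))" if "i + 2 < length p" for i
    using that step[of i] mod3(2)[OF c, of "p ! i"] by simp
  moreover have "c (p ! i) \<noteq> third_color c {p ! (i - 1), p ! i}" if "0 < i" "i + 1 < length p" for i
    using that edge[of "i - 1"] step[of "i - 1"] mod3(4)[OF c, of "p ! (i - 1)"] by simp
  moreover have "c (p ! i) \<noteq> third_color c {p ! i, p ! (i + 1)}" if "i + 1 < length p" for i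
    using that edge[of i] mod3(1)[OF c, of "p ! i"] by simp
  ultimately show ?thesis
    unfolding total_proper_path_def by blast
qed

lemma (in pair_graph) total_proper_connected_ascending:
  assumes "\<And>x. c x < 3"
    and "\<And>u v. u \<in> pverts G \<Longrightarrow> v \<in> pverts G \<Longrightarrow> (u, v) \<in> (ascending_arcs G c)\<^sup>*"
  shows "total_proper_connected G c (third_color c)"
  unfolding total_proper_connected_def
proof (intro ballI impI)
  fix u v assume "u \<in> pverts G" "v \<in> pverts G"
  moreover have "ascending_arcs G c \<subseteq> pverts G \<times> pverts G"
    using wellformed' by (auto simp: ascending_arcs_def)
  ultimately show "\<exists>p. total_proper_path G c (third_color c) p \<and> hd p = u \<and> last p = v"
    using assms total_proper_path_ascending rtrancl_vpath by metis
qed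

section \<open>Strong connectivity of the oriented product\<close>

text \<open>Within a block one coordinate can move along a parity-changing edge while the other
  stays fixed. Such edges connect each factor, so the coordinates are corrected one after the
  other.\<close>

lemma strong_product_ascending_connected:
  fixes f :: "'a \<Rightarrow> bool" and k :: "'b \<Rightarrow> bool"
  assumes "pair_graph G" "pair_graph H" "nontrivial G" "nontrivial H"
    and f: "\<And>u v. u \<in> pverts G \<Longrightarrow> v \<in> pverts G \<Longrightarrow> (u, v) \<in> {(x, y) \<in> parcs G. f x \<noteq> f y}\<^sup>*"
    and k: "\<And>u v. u \<in> pverts H \<Longrightarrow> v \<in> pverts H \<Longrightarrow> (u, v) \<in> {(x, y) \<in> parcs H. k x \<noteq> k y}\<^sup>*"
    and u: "u \<in> pverts (G \<boxtimes> H)" and v: "v \<in> pverts (G \<boxtimes> H)"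
  shows "(u, v) \<in> (ascending_arcs (G \<boxtimes> H) (\<lambda>(g, h). of_bool (f g) + of_bool (k h)))\<^sup>*"
proof -
  interpret G: pair_graph G by fact
  interpret H: pair_graph H by fact
  let ?SG = "{(x, y) \<in> parcs G. f x \<noteq> f y}" and ?SH = "{(x, y) \<in> parcs H. k x \<noteq> k y}"
  define c :: "'a \<times> 'b \<Rightarrow> nat" where "c = (\<lambda>(g, h). of_bool (f g) + of_bool (k h))"
  define D where "D = ascending_arcs (G \<boxtimes> H) c"
  have block: "((g, h), (g', h)) \<in> D\<^sup>* \<and> ((g, h), (g, h')) \<in> D\<^sup>*"
    if g: "(g, g') \<in> ?SG" and h: "(h, h') \<in> ?SH" for g g' h h'
  proof -
    have G_arcs: "(g, g') \<in> parcs G" "(g', g) \<in> parcs G" "g \<in> pverts G" "g' \<in> pverts G"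
      using g G.pair_sym_arcs G.wellformed' by (auto simp: symmetric_def sym_def)
    have H_arcs: "(h, h') \<in> parcs H" "(h', h) \<in> parcs H" "h \<in> pverts H" "h' \<in> pverts H"
      using h H.pair_sym_arcs H.wellformed' by (auto simp: symmetric_def sym_def)
    have arc: "(x, y) \<in> D"
      if "x \<in> {g, g'} \<times> {h, h'}" "y \<in> {g, g'} \<times> {h, h'}" "x \<noteq> y" "c y = (c x + 1) mod 3" for x y
    proof -
      have "(x, y) \<in> parcs (G \<boxtimes> H)"
        using that(1-3) G_arcs H_arcs by (auto simp: strong_product_def)
      then show ?thesis
        using that(4) by (simp add: D_def ascending_arcs_def)
    qed
    \<comment> \<open>Renaming the ends gives \<open>(a, b)\<close> color 0, \<open>(a', b)\<close>
      and \<open>(a, b')\<close> color 1, and \<open>(a', b')\<close> color 2.\<close>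
    obtain a a' where a: "{g, g'} = {a, a'}" "\<not> f a" "f a'"
      using g by auto
    obtain b b' where b: "{h, h'} = {b, b'}" "\<not> k b" "k b'"
      using h by auto
    \<comment> \<open>Four arcs climb from 0 to 2 by two routes; the last one, from 2 back to 0, is
      a diagonal of the block.\<close>
    have ab: "((a, b), (a', b)) \<in> D" "((a, b), (a, b')) \<in> D" "((a', b), (a', b')) \<in> D"
      "((a, b'), (a', b')) \<in> D" "((a', b'), (a, b)) \<in> D"
      by ((rule arc; (use a b in \<open>auto simp: c_def\<close>))+)
    have up: "((a, b), (a', b')) \<in> D\<^sup>*"
      using ab(1,3) by (meson r_into_rtrancl rtrancl_trans)
    \<comment> \<open>Climb from \<open>x\<close> to the top \<open>(a', b')\<close>, take the
      diagonal to the bottom \<open>(a, b)\<close>, then climb to \<open>y\<close>.\<close>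
    have "(x, y) \<in> D\<^sup>*" if "x \<in> {a, a'} \<times> {b, b'}" "y \<in> {a, a'} \<times> {b, b'}" for x y
    proof -
      have "(x, (a', b')) \<in> D\<^sup>*"
        using that(1) ab(3,4) up by auto
      moreover have "((a, b), y) \<in> D\<^sup>*"
        using that(2) ab(1,2) up by auto
      ultimately show ?thesis
        using ab(5) by (meson r_into_rtrancl rtrancl_trans)
    qed
    then show ?thesis
      unfolding a(1)[symmetric] b(1)[symmetric] by blast
  qed
  have left: "((g, h), (g', h)) \<in> D\<^sup>*" if g: "g \<in> pverts G" "g' \<in> pverts G" and h: "h \<in> pverts H" for g g' h
  proof -
    \<comment> \<open>One fixed neighbor \<open>h'\<close> serves for every block along the walk in
      \<open>G\<close>.\<close>
    obtain h' where h': "(h, h') \<in> ?SH"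
      using rtrancl_out_arc[OF k _ h] assms(4) unfolding nontrivial_def by blast
    from f[OF g] show ?thesis
    proof (induction rule: rtrancl_induct)
      case (step y z)
      with block[OF step(2) h'] show ?case by (meson rtrancl_trans)
    qed simp
  qed
  have right: "((g, h), (g, h')) \<in> D\<^sup>*" if h: "h \<in> pverts H" "h' \<in> pverts H" and g: "g \<in> pverts G" for g h h'
  proof -
    obtain g' where g': "(g, g') \<in> ?SG"
      using rtrancl_out_arc[OF f _ g] assms(3) unfolding nontrivial_def by blast
    from k[OF h] show ?thesis
    proof (induction rule: rtrancl_induct)
      case (step y z)
      with block[OF g' step(2)] show ?case by (meson rtrancl_trans)
    qed simp
  qed
  obtain g h g' h' where "u = (g, h)" "v = (g', h')"
    and "g \<in> pverts G" "h \<in> pverts H" "g' \<in> pverts G" "h' \<in> pverts H"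
    using u v by (auto simp: strong_product_def)
  then have "(u, v) \<in> D\<^sup>*"
    using rtrancl_trans[OF left right] by blast
  then show ?thesis
    by (simp add: D_def c_def)
qed

section \<open>The lower bound\<close>

lemma (in pair_graph) finite_edges: "finite (edges G)"
proof -
  have "edges G = (\<lambda>(u, v). {u, v}) ` parcs G"
    by (auto simp: edges_def)
  then show ?thesis
    using pair_finite_arcs by simp
qed

text \<open>A path between nonadjacent vertices has an internal vertex; the first one and its two
  path edges have pairwise different colors.\<close>

lemma (in pair_graph) three_le_card_colors:
  assumes "\<not> complete_graph G" "total_proper_connected G vc ec"
  shows "3 \<le> card (vc ` pverts G \<union> ec ` edges G)"
proof -
  have "parcs G \<subset> {(u, v). (u, v) \<in> pverts G \<times> pverts G \<and> u \<noteq> v}"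
  proof
    show "parcs G \<subseteq> {(u, v). (u, v) \<in> pverts G \<times> pverts G \<and> u \<noteq> v}"
      using wellformed' no_loops' by fast
    show "parcs G \<noteq> {(u, v). (u, v) \<in> pverts G \<times> pverts G \<and> u \<noteq> v}"
      using assms(1) pair_finite_verts unfolding complete_graph_def complete_digraph_pair_def by blast
  qed
  then obtain u v where uv: "u \<in> pverts G" "v \<in> pverts G" "u \<noteq> v" "(u, v) \<notin> parcs G"
    by blast
  obtain p where p: "total_proper_path G vc ec p" "hd p = u" "last p = v"
    using assms(2) uv by (auto simp: total_proper_connected_def)
  have walk: "set p \<subseteq> pverts G" "set (vwalk_arcs p) \<subseteq> parcs G" "p \<noteq> []"
    using p(1) by (auto simp: total_proper_path_def vpath_def vwalk_def)
  \<comment> \<open>A one-vertex path would force \<open>u = v\<close>, and a two-vertex path would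
    make \<open>u\<close> and \<open>v\<close> adjacent.\<close>
  obtain x y q where [simp]: "p = u # x # y # q"
    using walk p(2,3) uv by (cases p rule: vwalk_arcs.cases; cases "tl (tl p)") auto
  have edges_differ: "ec {p ! i, p ! (i + 1)} \<noteq> ec {p ! (i + 1), p ! (i + 2)}"
    if "i + 2 < length p" for i
    using p(1) that unfolding total_proper_path_def by blast
  have vertex_differs: "vc (p ! i) \<noteq> ec {p ! (i - 1), p ! i} \<and> vc (p ! i) \<noteq> ec {p ! i, p ! (i + 1)}"
    if "0 < i" "i + 1 < length p" for i
    using p(1) that unfolding total_proper_path_def by blast
  have "ec {u, x} \<noteq> ec {x, y}" "vc x \<noteq> ec {u, x}" "vc x \<noteq> ec {x, y}"
    using edges_differ[of 0] vertex_differs[of 1] by simp_all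
  then have "card {vc x, ec {u, x}, ec {x, y}} = 3"
    by auto
  moreover have "{vc x, ec {u, x}, ec {x, y}} \<subseteq> vc ` pverts G \<union> ec ` edges G"
    using walk by (auto simp: edges_def intro!: imageI)
  ultimately show ?thesis
    using card_mono pair_finite_verts finite_edges by (metis finite_UnI finite_imageI)
qed

theorem theorem6p1:
  fixes G :: "'a pair_pre_digraph" and H :: "'b pair_pre_digraph"
  assumes "pair_graph G" and "pair_graph H"
    and "nontrivial G" and "nontrivial H"
    and "Digraph_Component.connected (with_proj G)"
    and "Digraph_Component.connected (with_proj H)"
    and "\<not> complete_graph (G \<boxtimes> H)"
  shows "tpc (G \<boxtimes> H) = 3"
proof -
  interpret P: pair_graph "G \<boxtimes> H"
    using assms(1,2) by (rule pair_graph_strong_product)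
  obtain f :: "'a \<Rightarrow> bool"
    where f: "\<And>u v. u \<in> pverts G \<Longrightarrow> v \<in> pverts G \<Longrightarrow> (u, v) \<in> {(x, y) \<in> parcs G. f x \<noteq> f y}\<^sup>*"
    using pair_graph.connected_parity_bipartition[OF assms(1,5)] by blast
  obtain k :: "'b \<Rightarrow> bool"
    where k: "\<And>u v. u \<in> pverts H \<Longrightarrow> v \<in> pverts H \<Longrightarrow> (u, v) \<in> {(x, y) \<in> parcs H. k x \<noteq> k y}\<^sup>*"
    using pair_graph.connected_parity_bipartition[OF assms(2,6)] by blast
  define c :: "'a \<times> 'b \<Rightarrow> nat" where "c = (\<lambda>(g, h). of_bool (f g) + of_bool (k h))"
  have c3: "c x < 3" for x
    by (simp add: c_def split: prod.split)
  have tp: "total_proper_connected (G \<boxtimes> H) c (third_color c)"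
    using strong_product_ascending_connected[OF assms(1-4) f k] c3
    by (intro P.total_proper_connected_ascending) (auto simp: c_def)
  have "c ` pverts (G \<boxtimes> H) \<union> third_color c ` edges (G \<boxtimes> H) \<subseteq> {..<3}"
    using c3 by (auto simp: third_color_def)
  from card_mono[OF _ this]
  have "card (c ` pverts (G \<boxtimes> H) \<union> third_color c ` edges (G \<boxtimes> H)) \<le> 3"
    by simp
  \<comment> \<open>The lower bound, applied to this very coloring, shows that the value 3 is
    attained exactly, as the \<open>LEAST\<close> requires.\<close>
  with P.three_le_card_colors[OF assms(7) tp]
  have "card (c ` pverts (G \<boxtimes> H) \<union> third_color c ` edges (G \<boxtimes> H)) = 3"
    by simp
  with tp show ?thesis
    unfolding tpc_def using P.three_le_card_colors[OF assms(7)]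
    by (intro Least_equality) blast+
qed

end
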